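(* Let $V:\mathbb{R}^2\to\mathbb{R}$ and $W:\mathbb{R}^2\to\mathbb{R}$ be functions with $W(x,y)=W(-x,-y)$ for all $(x,y)$, and let $[a,b]\times[c,d]$ be partitioned by a (possibly nonuniform) Cartesian mesh as in the context. Let $\rho(t)=\{\rho_{i,j}(t)\}$, $t\ge0$, be a solution of the semi-discrete scheme $$\frac{d}{dt}\rho_{i,j}=\frac{C_{i+1/2,j}-C_{i-1/2,j}}{h^x_i}+\frac{C_{i,j+1/2}-C_{i,j-1/2}}{h^y_j},\qquad 1\le i\le N_x,\ 1\le j\le N_y,$$ with the fluxes defined in the context. Then: (1) Conservation of mass: for any $t>0$, $$\sum_{i=1}^{N_x}\sum_{j=1}^{N_y}h^x_ih^y_j\rho_{i,j}(t)=\sum_{i=1}^{N_x}\sum_{j=1}^{N_y}h^x_ih^y_j\rho_{i,j}(0).$$ (2) Positivity preserving: if $\rho_{i,j}(0)\ge0$ for all $i\in\{1,\dots,N_x\}$, $j\in\{1,\dots,N_y\}$, then $\rho_{i,j}(t)\ge 0$ for all $i,j$ and any $t>0$. (3) Entropy dissipation: at times $t>0$ at which $\rho_{i,j}(t)>0$ for all $i,j$ (so that the logarithms are defined), $\dfrac{dE_h(t)}{dt}\le -I_h$, where $$E_h(t)=\sum_{i=1}^{N_x}\sum_{j=1}^{N_y}h^x_ih^y_j\Big(\rho_{i,j}\log\rho_{i,j}+V(x_i,y_j)\rho_{i,j}+\tfrac12 g_{i,j}\rho_{i,j}\Big),$$ $$g_{i,j}=\sum_{k=1}^{N_x}\sum_{l=1}^{N_y}h^x_kh^y_lW(x_k-x_i,y_l-y_j)\rho_{k,l},$$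 and $$I_h=\sum_{j=1}^{N_y}\sum_{i=1}^{N_x-1}h^y_jC_{i+1/2,j}\left(\log\frac{\rho_{i+1,j}}{M_{i+1,j}}-\log\frac{\rho_{i,j}}{M_{i,j}}\right)+\sum_{i=1}^{N_x}\sum_{j=1}^{N_y-1}h^x_iC_{i,j+1/2}\left(\log\frac{\rho_{i,j+1}}{M_{i,j+1}}-\log\frac{\rho_{i,j}}{M_{i,j}}\right)\ge0.$$
   Context: Mesh: $\Omega=[a,b]\times[c,d]$ is partitioned into cells $I_{i,j}=[x_{i-1/2},x_{i+1/2}]\times[y_{j-1/2},y_{j+1/2}]$, $1\le i\le N_x$, $1\le j\le N_y$, with $x_{1/2}=a$, $x_{N_x+1/2}=b$, $y_{1/2}=c$, $y_{N_y+1/2}=d$, side lengths $h^x_i,h^y_j>0$, and centers $(x_i,y_j)=(x_{i-1/2}+\frac12h^x_i,\,y_{j-1/2}+\frac12h^y_j)$. Set $h^x_{i+1/2}=(h^x_i+h^x_{i+1})/2$ and $h^y_{j+1/2}=(h^y_j+h^y_{j+1})/2$. For $x,y\in\mathbb{R}$ and $v\in\mathbb{R}^{N_x\times N_y}$ define $$Q_2(x,y,v)=\exp\Big(-V(x,y)-\sum_{k=1}^{N_x}\sum_{l=1}^{N_y}h^x_kh^y_lW(x_k-x,y_l-y)v_{k,l}\Big).$$ Set $M_{i+1/2,j}=Q_2(x_{i+1/2},y_j,\rho)$, $M_{i,j+1/2}=Q_2(x_i,y_{j+1/2},\rho)$, $M_{i,j}=Q_2(x_i,y_j,\rho)$ (evaluated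 at the current $\rho=\rho(t)$). The fluxes are $$C_{i+1/2,j}=\frac{M_{i+1/2,j}}{h^x_{i+1/2}}\Big(\frac{\rho_{i+1,j}}{M_{i+1,j}}-\frac{\rho_{i,j}}{M_{i,j}}\Big),\quad 1\le i\le N_x-1,\ 1\le j\le N_y,$$ $$C_{i,j+1/2}=\frac{M_{i,j+1/2}}{h^y_{j+1/2}}\Big(\frac{\rho_{i,j+1}}{M_{i,j+1}}-\frac{\rho_{i,j}}{M_{i,j}}\Big),\quad 1\le i\le N_x,\ 1\le j\le N_y-1,$$ and $C_{1/2,j}=C_{N_x+1/2,j}=C_{i,1/2}=C_{i,N_y+1/2}=0$ for all $i,j$. The scheme discretizes $\partial_t\rho=\nabla\cdot(\nabla\rho+\rho\nabla(V+W*\rho))$ on $\Omega$ with zero flux boundary conditions. *)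

theory Defs
  imports "HOL-Analysis.Analysis"
begin

text \<open>
  A one-dimensional mesh on the interval from \<open>a\<close> to \<open>b\<close> with \<open>N\<close> cells is given by the sequence of
  its edges: \<open>e i\<close> stands for \<open>x\<^sub>i\<^sub>+\<^sub>1\<^sub>/\<^sub>2\<close>, and the \<open>i\<close>-th cell (\<open>1 \<le> i \<le> N\<close>) is \<open>{e (i - 1)..e i}\<close>.
  Only the values \<open>e 0, \<dots>, e N\<close> matter.
\<close>

definition mesh_1d :: "real \<Rightarrow> real \<Rightarrow> nat \<Rightarrow> (nat \<Rightarrow> real) \<Rightarrow> bool" where
  "mesh_1d a b N e \<longleftrightarrow> 1 \<le> N \<and> e 0 = a \<and> e N = b \<and> (\<forall>i\<in>{1..N}. e (i - 1) < e i)"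

definition cell_width :: "(nat \<Rightarrow> real) \<Rightarrow> nat \<Rightarrow> real" where
  "cell_width e i = e i - e (i - 1)"

definition cell_center :: "(nat \<Rightarrow> real) \<Rightarrow> nat \<Rightarrow> real" where
  "cell_center e i = e (i - 1) + cell_width e i / 2"

text \<open>\<open>edge_width e i\<close> is \<open>h\<^sub>i\<^sub>+\<^sub>1\<^sub>/\<^sub>2\<close>.\<close>

definition edge_width :: "(nat \<Rightarrow> real) \<Rightarrow> nat \<Rightarrow> real" where
  "edge_width e i = (cell_width e i + cell_width e (i + 1)) / 2"

text \<open>
  Grid functions are represented as \<open>v :: nat \<Rightarrow> nat \<Rightarrow> real\<close>, of which only the entries \<open>v i j\<close> with
  \<open>1 \<le> i \<le> Nx\<close> and \<open>1 \<le> j \<le> Ny\<close> are used.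
\<close>

definition Q2 ::
  "nat \<Rightarrow> nat \<Rightarrow> (nat \<Rightarrow> real) \<Rightarrow> (nat \<Rightarrow> real) \<Rightarrow> (real \<times> real \<Rightarrow> real) \<Rightarrow> (real \<times> real \<Rightarrow> real) \<Rightarrow>
   real \<Rightarrow> real \<Rightarrow> (nat \<Rightarrow> nat \<Rightarrow> real) \<Rightarrow> real" where
  "Q2 Nx Ny xe ye V W x y v =
     exp (- V (x, y) - (\<Sum>k=1..Nx. \<Sum>l=1..Ny. cell_width xe k * cell_width ye l *
            W (cell_center xe k - x, cell_center ye l - y) * v k l))"

definition M_cell ::
  "nat \<Rightarrow> nat \<Rightarrow> (nat \<Rightarrow> real) \<Rightarrow> (nat \<Rightarrow> real) \<Rightarrow> (real \<times> real \<Rightarrow> real) \<Rightarrow> (real \<times> real \<Rightarrow> real) \<Rightarrow>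
   (nat \<Rightarrow> nat \<Rightarrow> real) \<Rightarrow> nat \<Rightarrow> nat \<Rightarrow> real" where
  "M_cell Nx Ny xe ye V W v i j = Q2 Nx Ny xe ye V W (cell_center xe i) (cell_center ye j) v"

text \<open>
  Half-integer indices are shifted down: \<open>M_xedge \<dots> i j\<close> is \<open>M\<^sub>i\<^sub>+\<^sub>1\<^sub>/\<^sub>2\<^sub>,\<^sub>j\<close>, \<open>M_yedge \<dots> i j\<close> is
  \<open>M\<^sub>i\<^sub>,\<^sub>j\<^sub>+\<^sub>1\<^sub>/\<^sub>2\<close>, and likewise for the fluxes \<open>Cx\<close> and \<open>Cy\<close>, which vanish at the boundary edges
  \<open>0\<close> and \<open>Nx\<close> (respectively \<open>Ny\<close>).
\<close>

definition M_xedge ::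
  "nat \<Rightarrow> nat \<Rightarrow> (nat \<Rightarrow> real) \<Rightarrow> (nat \<Rightarrow> real) \<Rightarrow> (real \<times> real \<Rightarrow> real) \<Rightarrow> (real \<times> real \<Rightarrow> real) \<Rightarrow>
   (nat \<Rightarrow> nat \<Rightarrow> real) \<Rightarrow> nat \<Rightarrow> nat \<Rightarrow> real" where
  "M_xedge Nx Ny xe ye V W v i j = Q2 Nx Ny xe ye V W (xe i) (cell_center ye j) v"

definition M_yedge ::
  "nat \<Rightarrow> nat \<Rightarrow> (nat \<Rightarrow> real) \<Rightarrow> (nat \<Rightarrow> real) \<Rightarrow> (real \<times> real \<Rightarrow> real) \<Rightarrow> (real \<times> real \<Rightarrow> real) \<Rightarrow>
   (nat \<Rightarrow> nat \<Rightarrow> real) \<Rightarrow> nat \<Rightarrow> nat \<Rightarrow> real" where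
  "M_yedge Nx Ny xe ye V W v i j = Q2 Nx Ny xe ye V W (cell_center xe i) (ye j) v"

definition Cx ::
  "nat \<Rightarrow> nat \<Rightarrow> (nat \<Rightarrow> real) \<Rightarrow> (nat \<Rightarrow> real) \<Rightarrow> (real \<times> real \<Rightarrow> real) \<Rightarrow> (real \<times> real \<Rightarrow> real) \<Rightarrow>
   (nat \<Rightarrow> nat \<Rightarrow> real) \<Rightarrow> nat \<Rightarrow> nat \<Rightarrow> real" where
  "Cx Nx Ny xe ye V W v i j =
     (if 1 \<le> i \<and> i < Nx
      then M_xedge Nx Ny xe ye V W v i j / edge_width xe i *
             (v (i + 1) j / M_cell Nx Ny xe ye V W v (i + 1) j - v i j / M_cell Nx Ny xe ye V W v i j)
      else 0)"

definition Cy ::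
  "nat \<Rightarrow> nat \<Rightarrow> (nat \<Rightarrow> real) \<Rightarrow> (nat \<Rightarrow> real) \<Rightarrow> (real \<times> real \<Rightarrow> real) \<Rightarrow> (real \<times> real \<Rightarrow> real) \<Rightarrow>
   (nat \<Rightarrow> nat \<Rightarrow> real) \<Rightarrow> nat \<Rightarrow> nat \<Rightarrow> real" where
  "Cy Nx Ny xe ye V W v i j =
     (if 1 \<le> j \<and> j < Ny
      then M_yedge Nx Ny xe ye V W v i j / edge_width ye j *
             (v i (j + 1) / M_cell Nx Ny xe ye V W v i (j + 1) - v i j / M_cell Nx Ny xe ye V W v i j)
      else 0)"

text \<open>At \<open>t = 0\<close> the derivative is the one-sided one.\<close>

definition semidiscrete_solution ::
  "nat \<Rightarrow> nat \<Rightarrow> (nat \<Rightarrow> real) \<Rightarrow> (nat \<Rightarrow> real) \<Rightarrow> (real \<times> real \<Rightarrow> real) \<Rightarrow> (real \<times> real \<Rightarrow> real) \<Rightarrow>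
   (real \<Rightarrow> nat \<Rightarrow> nat \<Rightarrow> real) \<Rightarrow> bool" where
  "semidiscrete_solution Nx Ny xe ye V W \<rho> \<longleftrightarrow>
     (\<forall>t\<ge>0. \<forall>i\<in>{1..Nx}. \<forall>j\<in>{1..Ny}.
        ((\<lambda>s. \<rho> s i j) has_real_derivative
           (Cx Nx Ny xe ye V W (\<rho> t) i j - Cx Nx Ny xe ye V W (\<rho> t) (i - 1) j) / cell_width xe i +
           (Cy Nx Ny xe ye V W (\<rho> t) i j - Cy Nx Ny xe ye V W (\<rho> t) i (j - 1)) / cell_width ye j)
        (at t within {0..}))"

definition total_mass ::
  "nat \<Rightarrow> nat \<Rightarrow> (nat \<Rightarrow> real) \<Rightarrow> (nat \<Rightarrow> real) \<Rightarrow> (nat \<Rightarrow> nat \<Rightarrow> real) \<Rightarrow> real" where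
  "total_mass Nx Ny xe ye v = (\<Sum>i=1..Nx. \<Sum>j=1..Ny. cell_width xe i * cell_width ye j * v i j)"

definition g_cell ::
  "nat \<Rightarrow> nat \<Rightarrow> (nat \<Rightarrow> real) \<Rightarrow> (nat \<Rightarrow> real) \<Rightarrow> (real \<times> real \<Rightarrow> real) \<Rightarrow>
   (nat \<Rightarrow> nat \<Rightarrow> real) \<Rightarrow> nat \<Rightarrow> nat \<Rightarrow> real" where
  "g_cell Nx Ny xe ye W v i j =
     (\<Sum>k=1..Nx. \<Sum>l=1..Ny. cell_width xe k * cell_width ye l *
        W (cell_center xe k - cell_center xe i, cell_center ye l - cell_center ye j) * v k l)"

definition discrete_entropy ::
  "nat \<Rightarrow> nat \<Rightarrow> (nat \<Rightarrow> real) \<Rightarrow> (nat \<Rightarrow> real) \<Rightarrow> (real \<times> real \<Rightarrow> real) \<Rightarrow> (real \<times> real \<Rightarrow> real) \<Rightarrow>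
   (nat \<Rightarrow> nat \<Rightarrow> real) \<Rightarrow> real" where
  "discrete_entropy Nx Ny xe ye V W v =
     (\<Sum>i=1..Nx. \<Sum>j=1..Ny. cell_width xe i * cell_width ye j *
        (v i j * ln (v i j) + V (cell_center xe i, cell_center ye j) * v i j +
         1 / 2 * g_cell Nx Ny xe ye W v i j * v i j))"

definition entropy_dissipation ::
  "nat \<Rightarrow> nat \<Rightarrow> (nat \<Rightarrow> real) \<Rightarrow> (nat \<Rightarrow> real) \<Rightarrow> (real \<times> real \<Rightarrow> real) \<Rightarrow> (real \<times> real \<Rightarrow> real) \<Rightarrow>
   (nat \<Rightarrow> nat \<Rightarrow> real) \<Rightarrow> real" where
  "entropy_dissipation Nx Ny xe ye V W v =
     (\<Sum>j=1..Ny. \<Sum>i=1..<Nx. cell_width ye j * Cx Nx Ny xe ye V W v i j *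
        (ln (v (i + 1) j / M_cell Nx Ny xe ye V W v (i + 1) j) -
         ln (v i j / M_cell Nx Ny xe ye V W v i j))) +
     (\<Sum>i=1..Nx. \<Sum>j=1..<Ny. cell_width xe i * Cy Nx Ny xe ye V W v i j *
        (ln (v i (j + 1) / M_cell Nx Ny xe ye V W v i (j + 1)) -
         ln (v i j / M_cell Nx Ny xe ye V W v i j)))"

end

theory Submission
  imports Defs
begin

text \<open>
  Everything follows from one identity, the weak form of the scheme (\<open>weak_form\<close>). Multiply the
  equation of each cell by the area of the cell and by a test value \<open>\<phi> i j\<close>, and sum over all cells.
  Because the boundary fluxes vanish, summation by parts moves the differences from the fluxes to
  \<open>\<phi>\<close>: the result is minus the sum over interior edges of edge length times flux times jump of \<open>\<phi>\<close>.
  Each flux is a positive multiple of the jump of the ratio \<open>\<rho> / M\<close>, so the result is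
  nonpositive whenever \<open>\<phi>\<close> is a nondecreasing function of \<open>\<rho> / M\<close> (\<open>flux_pairing_nonneg\<close>).
  Three choices of \<open>\<phi>\<close> give the three claims.

  With \<open>\<phi> = 1\<close> there are no jumps, so the mass is constant.

  With \<open>\<phi> = min (\<rho> / M) 0\<close> the sum over the cells is, up to the time dependence of \<open>M\<close>, half the derivative
  of the energy \<open>\<Sum> h\<^sup>x h\<^sup>y (min \<rho> 0)\<^sup>2 / M\<close>. Since \<open>M = exp (- V - g)\<close>, the
  correction is the same sum with the extra factor \<open>dg/dt\<close>, which is continuous and hence bounded on
  bounded time intervals. By a Gronwall argument the energy stays zero if it starts at zero, and
  then no entry of \<open>\<rho>\<close> is negative.

  With \<open>\<phi> = ln (\<rho> / M) = ln \<rho> + V + g\<close> the sum over the cells is the derivative of the entropy: the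
  symmetry of \<open>W\<close> makes the two halves of the derivative of the quadratic interaction term equal
  (\<open>interaction_symmetric\<close>), and the summand \<open>1\<close> from the derivative of \<open>\<rho> ln \<rho>\<close> contributes nothing
  because mass is conserved. The inequality for the entropy is thus an equality.
\<close>

section \<open>Summation by parts, monotone jumps and a Gronwall estimate\<close>

lemma sum_by_parts_zero_boundary:
  fixes F \<phi> :: "nat \<Rightarrow> real"
  assumes "F 0 = 0" and "F N = 0"
  shows "(\<Sum>i=1..N. (F i - F (i - 1)) * \<phi> i) = - (\<Sum>i=1..<N. F i * (\<phi> (i + 1) - \<phi> i))"
proof -
  have "(\<Sum>i=1..n. (F i - F (i - 1)) * \<phi> i)
      = F n * \<phi> n - (\<Sum>i=1..<n. F i * (\<phi> (i + 1) - \<phi> i))" for n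
  proof (induction n)
    case 0
    then show ?case using assms by simp
  next
    case (Suc n)
    then show ?case using assms
      by (cases "n = 0") (simp_all add: algebra_simps)
  qed
  from this[of N] show ?thesis using assms by simp
qed

lemma DERIV_min_zero_squared:
  "((\<lambda>x::real. (min x 0)\<^sup>2) has_real_derivative 2 * min x 0) (at x)"
proof -
  consider "x < 0" | "x > 0" | "x = 0" by linarith
  then show ?thesis
  proof cases
    case 1
    have "((\<lambda>x::real. x\<^sup>2) has_real_derivative 2 * min x 0) (at x)"
      using 1 by (auto intro!: derivative_eq_intros)
    then show ?thesis
      by (rule has_field_derivative_transform_within_open[where S = "{..<0}"]) (use 1 in auto)
  next
    case 2
    have "((\<lambda>x::real. 0) has_real_derivative 2 * min x 0) (at x)"
      using 2 by auto
    then show ?thesis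
      by (rule has_field_derivative_transform_within_open[where S = "{0<..}"]) (use 2 in auto)
  next
    case 3
    have lim: "((\<lambda>y::real. min y 0) \<longlongrightarrow> 0) (at 0)"
      by (auto intro!: tendsto_eq_intros)
    have "((\<lambda>y::real. ((min y 0)\<^sup>2 - (min 0 0)\<^sup>2) / (y - 0)) \<longlongrightarrow> 0) (at 0)"
      by (rule Lim_transform_eventually[OF lim])
        (auto simp: eventually_at_filter min_def power2_eq_square)
    then show ?thesis using 3 by (simp add: has_field_derivative_iff)
  qed
qed

lemma at_within_half_line: "0 < t \<Longrightarrow> at t within {0..} = at (t::real)"
  by (rule at_within_interior) simp

lemma gronwall_nonpos:
  fixes N N' :: "real \<Rightarrow> real"
  assumes "0 \<le> T"
    and deriv: "\<And>t. 0 \<le> t \<Longrightarrow> (N has_real_derivative N' t) (at t within {0..})"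
    and bound: "\<And>t. 0 \<le> t \<Longrightarrow> t \<le> T \<Longrightarrow> N' t \<le> C * N t"
    and "N 0 \<le> 0"
  shows "N T \<le> 0"
proof -
  let ?f = "\<lambda>t. exp (- C * t) * N t"
  have "continuous_on {0..} N"
    unfolding continuous_on_eq_continuous_within
    using deriv by (auto intro: DERIV_continuous)
  then have "continuous_on {0..T} N"
    by (rule continuous_on_subset) auto
  then have cont: "continuous_on {0..T} ?f"
    by (intro continuous_intros)
  have "?f T \<le> ?f 0"
  proof (rule DERIV_nonpos_imp_decreasing_open[OF \<open>0 \<le> T\<close> _ cont])
    fix t assume t: "0 < t" "t < T"
    have "(N has_real_derivative N' t) (at t)"
      using deriv[of t] t by (simp add: at_within_half_line)
    then have "(?f has_real_derivative exp (- C * t) * (N' t - C * N t)) (at t)"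
      by (auto intro!: derivative_eq_intros simp: algebra_simps)
    moreover have "exp (- C * t) * (N' t - C * N t) \<le> 0"
      using bound[of t] t by (simp add: mult_nonneg_nonpos)
    ultimately show "\<exists>y. (?f has_real_derivative y) (at t) \<and> y \<le> 0" by blast
  qed
  then have "exp (- C * T) * N T \<le> 0" using \<open>N 0 \<le> 0\<close> by simp
  then show ?thesis by (simp add: mult_le_0_iff not_le)
qed

lemma jump_mult_nonneg:
  fixes f :: "real \<Rightarrow> real"
  assumes "mono_on S f" "p \<in> S" "q \<in> S"
  shows "0 \<le> (q - p) * (f q - f p)"
  using assms by (cases "p \<le> q") (auto simp: zero_le_mult_iff dest: mono_onD)

section \<open>The weak form of the scheme\<close>

locale finite_volume_scheme =
  fixes Nx Ny :: nat and xe ye :: "nat \<Rightarrow> real" and V W :: "real \<times> real \<Rightarrow> real"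
  assumes width_x_pos: "i \<in> {1..Nx} \<Longrightarrow> 0 < cell_width xe i"
    and width_y_pos: "j \<in> {1..Ny} \<Longrightarrow> 0 < cell_width ye j"
begin

abbreviation M where "M \<equiv> M_cell Nx Ny xe ye V W"
abbreviation g where "g \<equiv> g_cell Nx Ny xe ye W"

abbreviation cell_sum :: "(nat \<Rightarrow> nat \<Rightarrow> real) \<Rightarrow> real" where
  "cell_sum f \<equiv> \<Sum>i=1..Nx. \<Sum>j=1..Ny. cell_width xe i * cell_width ye j * f i j"

definition rate :: "(nat \<Rightarrow> nat \<Rightarrow> real) \<Rightarrow> nat \<Rightarrow> nat \<Rightarrow> real" where
  "rate v i j =
     (Cx Nx Ny xe ye V W v i j - Cx Nx Ny xe ye V W v (i - 1) j) / cell_width xe i +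
     (Cy Nx Ny xe ye V W v i j - Cy Nx Ny xe ye V W v i (j - 1)) / cell_width ye j"

definition flux_pairing :: "(nat \<Rightarrow> nat \<Rightarrow> real) \<Rightarrow> (nat \<Rightarrow> nat \<Rightarrow> real) \<Rightarrow> real" where
  "flux_pairing v \<phi> =
     (\<Sum>j=1..Ny. \<Sum>i=1..<Nx. cell_width ye j * Cx Nx Ny xe ye V W v i j * (\<phi> (i + 1) j - \<phi> i j)) +
     (\<Sum>i=1..Nx. \<Sum>j=1..<Ny. cell_width xe i * Cy Nx Ny xe ye V W v i j * (\<phi> i (j + 1) - \<phi> i j))"

lemma M_pos: "0 < M v i j"
  by (simp add: M_cell_def Q2_def)

lemma M_eq_exp: "M v i j = exp (- V (cell_center xe i, cell_center ye j) - g v i j)"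
  by (simp add: M_cell_def Q2_def g_cell_def)

lemma edge_width_x_pos: "i \<in> {1..<Nx} \<Longrightarrow> 0 < edge_width xe i"
  using width_x_pos[of i] width_x_pos[of "i + 1"] by (simp add: edge_width_def)

lemma edge_width_y_pos: "j \<in> {1..<Ny} \<Longrightarrow> 0 < edge_width ye j"
  using width_y_pos[of j] width_y_pos[of "j + 1"] by (simp add: edge_width_def)

text \<open>
  Division by the cell widths cancels against the cell area, which leaves along each grid line a
  difference of fluxes whose first and last entries are zero.
\<close>

lemma weak_form: "cell_sum (\<lambda>i j. rate v i j * \<phi> i j) = - flux_pairing v \<phi>"
proof -
  let ?X = "Cx Nx Ny xe ye V W v" and ?Y = "Cy Nx Ny xe ye V W v"
  have cell: "cell_width xe i * cell_width ye j * (rate v i j * \<phi> i j)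
      = cell_width ye j * ((?X i j - ?X (i - 1) j) * \<phi> i j)
      + cell_width xe i * ((?Y i j - ?Y i (j - 1)) * \<phi> i j)"
    if "i \<in> {1..Nx}" "j \<in> {1..Ny}" for i j
    using width_x_pos[OF that(1)] width_y_pos[OF that(2)]
    by (simp add: rate_def field_simps)
  have "cell_sum (\<lambda>i j. rate v i j * \<phi> i j)
      = (\<Sum>i=1..Nx. \<Sum>j=1..Ny. cell_width ye j * ((?X i j - ?X (i - 1) j) * \<phi> i j))
      + (\<Sum>i=1..Nx. \<Sum>j=1..Ny. cell_width xe i * ((?Y i j - ?Y i (j - 1)) * \<phi> i j))"
    by (simp add: cell sum.distrib)
  also have "(\<Sum>i=1..Nx. \<Sum>j=1..Ny. cell_width ye j * ((?X i j - ?X (i - 1) j) * \<phi> i j))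
      = (\<Sum>j=1..Ny. cell_width ye j * (\<Sum>i=1..Nx. (?X i j - ?X (i - 1) j) * \<phi> i j))"
    by (subst sum.swap) (simp add: sum_distrib_left)
  also have "\<dots> = - (\<Sum>j=1..Ny. \<Sum>i=1..<Nx. cell_width ye j * ?X i j * (\<phi> (i + 1) j - \<phi> i j))"
    by (subst sum_by_parts_zero_boundary)
      (simp_all add: Cx_def sum_distrib_left sum_negf mult.assoc)
  also have "(\<Sum>i=1..Nx. \<Sum>j=1..Ny. cell_width xe i * ((?Y i j - ?Y i (j - 1)) * \<phi> i j))
      = (\<Sum>i=1..Nx. cell_width xe i * (\<Sum>j=1..Ny. (?Y i j - ?Y i (j - 1)) * \<phi> i j))"
    by (simp add: sum_distrib_left)
  also have "\<dots> = - (\<Sum>i=1..Nx. \<Sum>j=1..<Ny. cell_width xe i * ?Y i j * (\<phi> i (j + 1) - \<phi> i j))"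
    by (subst sum_by_parts_zero_boundary)
      (simp_all add: Cy_def sum_distrib_left sum_negf mult.assoc)
  finally show ?thesis by (simp add: flux_pairing_def)
qed

text \<open>
  Since each flux is a positive multiple of the jump of \<open>v / M\<close>, every edge contributes a product of
  two jumps of the same sign.
\<close>

lemma flux_pairing_nonneg:
  assumes f: "mono_on S f"
    and S: "\<And>i j. i \<in> {1..Nx} \<Longrightarrow> j \<in> {1..Ny} \<Longrightarrow> v i j / M v i j \<in> S"
  shows "0 \<le> flux_pairing v (\<lambda>i j. f (v i j / M v i j))"
proof -
  have edge: "0 \<le> h * (m / w * (q - p)) * (f q - f p)"
    if "0 < h" "0 < m" "0 < w" "p \<in> S" "q \<in> S" for h m w p q
  proof -
    have "0 \<le> h * (m / w) * ((q - p) * (f q - f p))"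
      using that by (intro mult_nonneg_nonneg jump_mult_nonneg[OF f]) auto
    then show ?thesis by (simp add: mult_ac)
  qed
  show ?thesis
    unfolding flux_pairing_def
  proof (intro add_nonneg_nonneg sum_nonneg)
    fix i j assume ij: "j \<in> {1..Ny}" "i \<in> {1..<Nx}"
    have "0 < M_xedge Nx Ny xe ye V W v i j" by (simp add: M_xedge_def Q2_def)
    with edge[OF width_y_pos this edge_width_x_pos S S, of j i i j "i + 1" j] ij
    show "0 \<le> cell_width ye j * Cx Nx Ny xe ye V W v i j
        * (f (v (i + 1) j / M v (i + 1) j) - f (v i j / M v i j))"
      by (simp add: Cx_def)
  next
    fix i j assume ij: "i \<in> {1..Nx}" "j \<in> {1..<Ny}"
    have "0 < M_yedge Nx Ny xe ye V W v i j" by (simp add: M_yedge_def Q2_def)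
    with edge[OF width_x_pos this edge_width_y_pos S S, of i j i j i "j + 1"] ij
    show "0 \<le> cell_width xe i * Cy Nx Ny xe ye V W v i j
        * (f (v i (j + 1) / M v i (j + 1)) - f (v i j / M v i j))"
      by (simp add: Cy_def)
  qed
qed

section \<open>Conservation of mass\<close>

lemma solution_deriv:
  assumes "semidiscrete_solution Nx Ny xe ye V W \<rho>" "0 \<le> t" "i \<in> {1..Nx}" "j \<in> {1..Ny}"
  shows "((\<lambda>s. \<rho> s i j) has_real_derivative rate (\<rho> t) i j) (at t within {0..})"
  using assms by (auto simp: semidiscrete_solution_def rate_def)

lemma sum_rate_zero: "cell_sum (rate v) = 0"
  using weak_form[of v "\<lambda>_ _. 1"] by (simp add: flux_pairing_def)

lemma mass_conserved:
  assumes sol: "semidiscrete_solution Nx Ny xe ye V W \<rho>" and "0 \<le> t"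
  shows "total_mass Nx Ny xe ye (\<rho> t) = total_mass Nx Ny xe ye (\<rho> 0)"
proof -
  have "((\<lambda>t. total_mass Nx Ny xe ye (\<rho> t)) has_real_derivative 0) (at t within {0..})"
    if t: "t \<in> {0..}" for t
  proof -
    have "((\<lambda>t. total_mass Nx Ny xe ye (\<rho> t)) has_real_derivative cell_sum (rate (\<rho> t)))
        (at t within {0..})"
      unfolding total_mass_def
      by (intro DERIV_sum DERIV_cmult solution_deriv[OF sol]) (use t in auto)
    then show ?thesis unfolding sum_rate_zero .
  qed
  then obtain c where "total_mass Nx Ny xe ye (\<rho> t) = c" if "t \<in> {0..}" for t
    using has_field_derivative_zero_constant[of "{0..}" "\<lambda>t. total_mass Nx Ny xe ye (\<rho> t)"]
    by (metis convex_real_interval(1))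
  then show ?thesis using \<open>0 \<le> t\<close> by simp
qed

section \<open>Preservation of nonnegativity\<close>

text \<open>
  The interaction potential is linear in the grid function, so differentiating it in time amounts to
  applying it to the rates.
\<close>

lemma g_deriv:
  assumes "semidiscrete_solution Nx Ny xe ye V W \<rho>" "0 \<le> t"
  shows "((\<lambda>s. g (\<rho> s) i j) has_real_derivative g (rate (\<rho> t)) i j) (at t within {0..})"
  unfolding g_cell_def
  by (intro DERIV_sum DERIV_cmult solution_deriv[OF assms])

lemma solution_continuous:
  assumes "semidiscrete_solution Nx Ny xe ye V W \<rho>" "i \<in> {1..Nx}" "j \<in> {1..Ny}"
  shows "continuous_on {0..} (\<lambda>t. \<rho> t i j)"
  unfolding continuous_on_eq_continuous_within
  using solution_deriv[OF assms(1) _ assms(2,3)] by (auto intro: DERIV_continuous)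

lemma Q2_continuous:
  assumes "semidiscrete_solution Nx Ny xe ye V W \<rho>"
  shows "continuous_on {0..} (\<lambda>t. Q2 Nx Ny xe ye V W x y (\<rho> t))"
  unfolding Q2_def by (intro continuous_intros solution_continuous[OF assms])

lemma Cx_continuous:
  assumes "semidiscrete_solution Nx Ny xe ye V W \<rho>" "j \<in> {1..Ny}"
  shows "continuous_on {0..} (\<lambda>t. Cx Nx Ny xe ye V W (\<rho> t) i j)"
proof (cases "1 \<le> i \<and> i < Nx")
  case True
  have "M (\<rho> t) k j \<noteq> 0" for t k using M_pos[of "\<rho> t" k j] by simp
  with True edge_width_x_pos[of i] show ?thesis
    unfolding Cx_def M_xedge_def M_cell_def
    by (auto intro!: continuous_intros Q2_continuous[OF assms(1)] solution_continuous[OF assms(1)] assms(2))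
next
  case False
  then show ?thesis by (auto simp: Cx_def)
qed

lemma Cy_continuous:
  assumes "semidiscrete_solution Nx Ny xe ye V W \<rho>" "i \<in> {1..Nx}"
  shows "continuous_on {0..} (\<lambda>t. Cy Nx Ny xe ye V W (\<rho> t) i j)"
proof (cases "1 \<le> j \<and> j < Ny")
  case True
  have "M (\<rho> t) i k \<noteq> 0" for t k using M_pos[of "\<rho> t" i k] by simp
  with True edge_width_y_pos[of j] show ?thesis
    unfolding Cy_def M_yedge_def M_cell_def
    by (auto intro!: continuous_intros Q2_continuous[OF assms(1)] solution_continuous[OF assms(1)] assms(2))
next
  case False
  then show ?thesis by (auto simp: Cy_def)
qed

lemma g_rate_continuous:
  assumes sol: "semidiscrete_solution Nx Ny xe ye V W \<rho>"
  shows "continuous_on {0..} (\<lambda>t. g (rate (\<rho> t)) i j)"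
proof -
  have "continuous_on {0..} (\<lambda>t. rate (\<rho> t) k l)" if "k \<in> {1..Nx}" "l \<in> {1..Ny}" for k l
    unfolding rate_def
    using that width_x_pos[of k] width_y_pos[of l]
    by (auto intro!: continuous_intros Cx_continuous[OF sol] Cy_continuous[OF sol])
  then show ?thesis unfolding g_cell_def by (intro continuous_intros)
qed

text \<open>
  The bound that the Gronwall argument needs: summing the absolute values over all cells gives one
  continuous function that dominates every cell.
\<close>

lemma g_rate_bounded:
  assumes sol: "semidiscrete_solution Nx Ny xe ye V W \<rho>"
  obtains C where "\<And>t i j. 0 \<le> t \<Longrightarrow> t \<le> T \<Longrightarrow> i \<in> {1..Nx} \<Longrightarrow> j \<in> {1..Ny} \<Longrightarrow>
    g (rate (\<rho> t)) i j \<le> C"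
proof -
  let ?B = "\<lambda>t. \<Sum>(i, j)\<in>{1..Nx} \<times> {1..Ny}. \<bar>g (rate (\<rho> t)) i j\<bar>"
  have "continuous_on {0..T} (\<lambda>t. g (rate (\<rho> t)) i j)" for i j
    using g_rate_continuous[OF sol] by (rule continuous_on_subset) auto
  then have "continuous_on {0..T} ?B"
    by (auto intro!: continuous_intros simp: case_prod_unfold)
  then have "bounded (?B ` {0..T})"
    by (intro compact_imp_bounded compact_continuous_image) auto
  then obtain C where C: "\<forall>t\<in>{0..T}. \<bar>?B t\<bar> \<le> C"
    unfolding bounded_iff by auto
  show thesis
  proof
    fix t i j assume *: "0 \<le> t" "t \<le> T" "i \<in> {1..Nx}" "j \<in> {1..Ny}"
    have "\<bar>g (rate (\<rho> t)) i j\<bar> \<le> ?B t"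
      using member_le_sum[of "(i, j)" "{1..Nx} \<times> {1..Ny}" "\<lambda>(i, j). \<bar>g (rate (\<rho> t)) i j\<bar>"] *
      by auto
    also have "\<dots> \<le> C" using C * by (meson abs_le_D1 atLeastAtMost_iff)
    finally show "g (rate (\<rho> t)) i j \<le> C" by linarith
  qed
qed

text \<open>
  The weight \<open>1 / M\<close> is what lets the monotone test function \<open>min (v / M) 0\<close> appear in the derivative
  of this energy; the pairing with the fluxes need not have a sign for functions that are monotone in \<open>v\<close> only.
\<close>

definition negative_energy :: "(nat \<Rightarrow> nat \<Rightarrow> real) \<Rightarrow> real" where
  "negative_energy v = cell_sum (\<lambda>i j. (min (v i j) 0)\<^sup>2 / M v i j)"

lemma negative_energy_deriv:
  assumes sol: "semidiscrete_solution Nx Ny xe ye V W \<rho>" and t: "0 \<le> t"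
  shows "((\<lambda>s. negative_energy (\<rho> s)) has_real_derivative
      - 2 * flux_pairing (\<rho> t) (\<lambda>i j. min (\<rho> t i j / M (\<rho> t) i j) 0)
      + cell_sum (\<lambda>i j. (min (\<rho> t i j) 0)\<^sup>2 / M (\<rho> t) i j * g (rate (\<rho> t)) i j))
    (at t within {0..})"
proof -
  let ?v = "\<rho> t"
  let ?D = "\<lambda>i j. 2 * (rate ?v i j * min (?v i j / M ?v i j) 0)
      + (min (?v i j) 0)\<^sup>2 / M ?v i j * g (rate ?v) i j"
  have cell: "((\<lambda>s. (min (\<rho> s i j) 0)\<^sup>2 / M (\<rho> s) i j) has_real_derivative ?D i j) (at t within {0..})"
    if "i \<in> {1..Nx}" "j \<in> {1..Ny}" for i j
  proof -
    let ?V = "V (cell_center xe i, cell_center ye j)"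
    have inv_M: "1 / M v i j = exp (?V + g v i j)" for v
      by (simp add: M_eq_exp exp_diff exp_minus exp_add field_simps)
    have min_M: "min (?v i j) 0 * (1 / M ?v i j) = min (?v i j / M ?v i j) 0"
      using M_pos[of ?v i j] by (auto simp: min_def divide_le_0_iff)
    have "((\<lambda>s. (min (\<rho> s i j) 0)\<^sup>2) has_real_derivative 2 * min (?v i j) 0 * rate ?v i j)
        (at t within {0..})"
      by (rule DERIV_chain2[OF DERIV_min_zero_squared solution_deriv[OF sol t that]])
    moreover have "((\<lambda>s. 1 / M (\<rho> s) i j) has_real_derivative 1 / M ?v i j * g (rate ?v) i j)
        (at t within {0..})"
      unfolding inv_M by (auto intro!: derivative_eq_intros g_deriv[OF sol t])
    ultimately have "((\<lambda>s. (min (\<rho> s i j) 0)\<^sup>2 * (1 / M (\<rho> s) i j)) has_real_derivative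
        2 * (rate ?v i j * (min (?v i j) 0 * (1 / M ?v i j)))
        + (min (?v i j) 0)\<^sup>2 * (1 / M ?v i j) * g (rate ?v) i j) (at t within {0..})"
      by (rule DERIV_mult[THEN DERIV_cong]) (simp add: algebra_simps)
    then show ?thesis by (simp only: min_M) simp
  qed
  have "((\<lambda>s. negative_energy (\<rho> s)) has_real_derivative cell_sum ?D) (at t within {0..})"
    unfolding negative_energy_def by (intro DERIV_sum DERIV_cmult cell)
  moreover have "cell_sum ?D = 2 * cell_sum (\<lambda>i j. rate ?v i j * min (?v i j / M ?v i j) 0)
      + cell_sum (\<lambda>i j. (min (?v i j) 0)\<^sup>2 / M ?v i j * g (rate ?v) i j)"
    by (simp add: distrib_left sum.distrib sum_distrib_left mult_ac)
  ultimately show ?thesis by (simp only: weak_form) simp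
qed

lemma nonnegativity_preserved:
  assumes sol: "semidiscrete_solution Nx Ny xe ye V W \<rho>"
    and init: "\<And>i j. i \<in> {1..Nx} \<Longrightarrow> j \<in> {1..Ny} \<Longrightarrow> 0 \<le> \<rho> 0 i j"
    and "0 \<le> T" and ij: "i \<in> {1..Nx}" "j \<in> {1..Ny}"
  shows "0 \<le> \<rho> T i j"
proof -
  obtain C where C: "\<And>t i j. 0 \<le> t \<Longrightarrow> t \<le> T \<Longrightarrow> i \<in> {1..Nx} \<Longrightarrow> j \<in> {1..Ny} \<Longrightarrow>
      g (rate (\<rho> t)) i j \<le> C"
    using g_rate_bounded[OF sol, where T = T] by blast
  have term_nonneg: "0 \<le> cell_width xe i * cell_width ye j * ((min (v i j) 0)\<^sup>2 / M v i j)"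
    if "i \<in> {1..Nx}" "j \<in> {1..Ny}" for v i j
    using width_x_pos[OF that(1)] width_y_pos[OF that(2)] M_pos[of v i j] by simp
  have "negative_energy (\<rho> T) \<le> 0"
  proof (rule gronwall_nonpos[OF \<open>0 \<le> T\<close> negative_energy_deriv[OF sol]])
    fix t assume t: "0 \<le> t" "t \<le> T"
    have "0 \<le> flux_pairing (\<rho> t) (\<lambda>i j. min (\<rho> t i j / M (\<rho> t) i j) 0)"
      by (rule flux_pairing_nonneg[of UNIV "\<lambda>x. min x 0"]) (auto intro!: mono_onI)
    moreover have "cell_sum (\<lambda>i j. (min (\<rho> t i j) 0)\<^sup>2 / M (\<rho> t) i j * g (rate (\<rho> t)) i j)
        \<le> C * negative_energy (\<rho> t)"
      unfolding negative_energy_def sum_distrib_left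
    proof (intro sum_mono)
      fix i j assume "i \<in> {1..Nx}" "j \<in> {1..Ny}"
      from mult_right_mono[OF C[OF t this] term_nonneg[OF this, of "\<rho> t"]]
      show "cell_width xe i * cell_width ye j * ((min (\<rho> t i j) 0)\<^sup>2 / M (\<rho> t) i j * g (rate (\<rho> t)) i j)
          \<le> C * (cell_width xe i * cell_width ye j * ((min (\<rho> t i j) 0)\<^sup>2 / M (\<rho> t) i j))"
        by (simp add: mult_ac)
    qed
    ultimately show "- 2 * flux_pairing (\<rho> t) (\<lambda>i j. min (\<rho> t i j / M (\<rho> t) i j) 0)
        + cell_sum (\<lambda>i j. (min (\<rho> t i j) 0)\<^sup>2 / M (\<rho> t) i j * g (rate (\<rho> t)) i j)
        \<le> C * negative_energy (\<rho> t)"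
      by linarith
  next
    show "negative_energy (\<rho> 0) \<le> 0"
      by (simp add: negative_energy_def init min_absorb2)
  qed
  moreover have "cell_width xe i * cell_width ye j * ((min (\<rho> T i j) 0)\<^sup>2 / M (\<rho> T) i j)
      \<le> negative_energy (\<rho> T)"
  proof -
    have "cell_width xe i * cell_width ye j * ((min (\<rho> T i j) 0)\<^sup>2 / M (\<rho> T) i j)
        \<le> (\<Sum>j=1..Ny. cell_width xe i * cell_width ye j * ((min (\<rho> T i j) 0)\<^sup>2 / M (\<rho> T) i j))"
      using ij term_nonneg by (intro member_le_sum) auto
    also have "\<dots> \<le> negative_energy (\<rho> T)"
      unfolding negative_energy_def
      using ij term_nonneg by (intro member_le_sum[where i = i] sum_nonneg) auto
    finally show ?thesis .
  qed
  ultimately have "(min (\<rho> T i j) 0)\<^sup>2 \<le> 0"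
    using width_x_pos[OF ij(1)] width_y_pos[OF ij(2)] M_pos[of "\<rho> T" i j]
    by (smt (verit) divide_pos_pos mult_pos_pos)
  then show ?thesis by (simp add: min_def split: if_splits)
qed

section \<open>Dissipation of entropy\<close>

lemma entropy_dissipation_eq:
  "entropy_dissipation Nx Ny xe ye V W v = flux_pairing v (\<lambda>i j. ln (v i j / M v i j))"
  by (simp add: entropy_dissipation_def flux_pairing_def)

text \<open>
  The symmetry of \<open>W\<close> makes the interaction kernel between two cells independent of their order, so
  \<open>g\<close> is self-adjoint for the inner product weighted by cell areas.
\<close>

lemma interaction_symmetric:
  assumes W_sym: "\<And>x y. W (x, y) = W (- x, - y)"
  shows "cell_sum (\<lambda>i j. g u i j * v i j) = cell_sum (\<lambda>i j. g v i j * u i j)"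
proof -
  let ?w = "\<lambda>p. cell_width xe (fst p) * cell_width ye (snd p)"
  let ?K = "\<lambda>p q. W (cell_center xe (fst q) - cell_center xe (fst p),
                     cell_center ye (snd q) - cell_center ye (snd p))"
  let ?S = "{1..Nx} \<times> {1..Ny}"
  have expand: "cell_sum (\<lambda>i j. g a i j * b i j)
      = (\<Sum>p\<in>?S. \<Sum>q\<in>?S. ?w p * ?w q * ?K p q * a (fst q) (snd q) * b (fst p) (snd p))" for a b
    unfolding g_cell_def sum.cartesian_product
    by (simp add: case_prod_unfold sum_distrib_left sum_distrib_right sum.cartesian_product mult_ac)
  have "?K p q = ?K q p" for p q
    using W_sym[of "cell_center xe (fst q) - cell_center xe (fst p)"
        "cell_center ye (snd q) - cell_center ye (snd p)"] by simp
  then show ?thesis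
    unfolding expand by (subst sum.swap) (simp add: mult_ac)
qed

lemma entropy_deriv:
  assumes W_sym: "\<And>x y. W (x, y) = W (- x, - y)"
    and sol: "semidiscrete_solution Nx Ny xe ye V W \<rho>" and "0 \<le> t"
    and pos: "\<And>i j. i \<in> {1..Nx} \<Longrightarrow> j \<in> {1..Ny} \<Longrightarrow> 0 < \<rho> t i j"
  shows "((\<lambda>s. discrete_entropy Nx Ny xe ye V W (\<rho> s)) has_real_derivative
      - entropy_dissipation Nx Ny xe ye V W (\<rho> t)) (at t within {0..})"
proof -
  let ?v = "\<rho> t"
  let ?r = "rate ?v"
  let ?V = "\<lambda>i j. V (cell_center xe i, cell_center ye j)"
  (* The product rule yields half of g times the rate, while ln (v / M) already contains all of it.
     The last two terms correct this; they cancel after summation, as g is self-adjoint. *)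
  let ?D = "\<lambda>i j. ?r i j * ln (?v i j / M ?v i j) + ?r i j
      + 1 / 2 * (g ?r i j * ?v i j) - 1 / 2 * (g ?v i j * ?r i j)"
  have cell: "((\<lambda>s. \<rho> s i j * ln (\<rho> s i j) + ?V i j * \<rho> s i j + 1 / 2 * g (\<rho> s) i j * \<rho> s i j)
      has_real_derivative ?D i j) (at t within {0..})"
    if ij: "i \<in> {1..Nx}" "j \<in> {1..Ny}" for i j
  proof -
    have ln_ratio: "ln (?v i j / M ?v i j) = ln (?v i j) + ?V i j + g ?v i j"
      using pos[OF ij] by (simp add: M_eq_exp ln_div)
    show ?thesis
      unfolding ln_ratio using pos[OF ij]
      by (auto intro!: derivative_eq_intros solution_deriv[OF sol \<open>0 \<le> t\<close> ij]
          g_deriv[OF sol \<open>0 \<le> t\<close>] simp: field_simps)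
  qed
  have "((\<lambda>s. discrete_entropy Nx Ny xe ye V W (\<rho> s)) has_real_derivative cell_sum ?D)
      (at t within {0..})"
    unfolding discrete_entropy_def by (intro DERIV_sum DERIV_cmult cell)
  moreover have "cell_sum ?D = cell_sum (\<lambda>i j. ?r i j * ln (?v i j / M ?v i j)) + cell_sum ?r
      + 1 / 2 * cell_sum (\<lambda>i j. g ?r i j * ?v i j) - 1 / 2 * cell_sum (\<lambda>i j. g ?v i j * ?r i j)"
    by (simp add: distrib_left right_diff_distrib sum.distrib sum_subtractf sum_distrib_left mult_ac)
  ultimately show ?thesis
    by (simp only: weak_form sum_rate_zero interaction_symmetric[OF W_sym, of ?r ?v] entropy_dissipation_eq) simp
qed

lemma entropy_dissipation_nonneg:
  assumes "\<And>i j. i \<in> {1..Nx} \<Longrightarrow> j \<in> {1..Ny} \<Longrightarrow> 0 < v i j"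
  shows "0 \<le> entropy_dissipation Nx Ny xe ye V W v"
  unfolding entropy_dissipation_eq
  by (rule flux_pairing_nonneg[of "{0<..}"]) (use assms M_pos in \<open>auto intro!: mono_onI\<close>)

end

lemma mesh_cell_width_pos: "mesh_1d a b N e \<Longrightarrow> i \<in> {1..N} \<Longrightarrow> 0 < cell_width e i"
  by (simp add: mesh_1d_def cell_width_def)

section \<open>The three properties of the scheme\<close>

theorem theorem4p1:
  fixes V W :: "real \<times> real \<Rightarrow> real"
    and a b c d :: real
    and Nx Ny :: nat
    and xe ye :: "nat \<Rightarrow> real"
    and \<rho> :: "real \<Rightarrow> nat \<Rightarrow> nat \<Rightarrow> real"
  assumes W_sym: "\<And>x y. W (x, y) = W (- x, - y)"
    and mesh_x: "mesh_1d a b Nx xe"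
    and mesh_y: "mesh_1d c d Ny ye"
    and sol: "semidiscrete_solution Nx Ny xe ye V W \<rho>"
  shows
    "(\<forall>t>0. total_mass Nx Ny xe ye (\<rho> t) = total_mass Nx Ny xe ye (\<rho> 0)) \<and>
     ((\<forall>i\<in>{1..Nx}. \<forall>j\<in>{1..Ny}. \<rho> 0 i j \<ge> 0) \<longrightarrow>
        (\<forall>t>0. \<forall>i\<in>{1..Nx}. \<forall>j\<in>{1..Ny}. \<rho> t i j \<ge> 0)) \<and>
     (\<forall>t>0. (\<forall>i\<in>{1..Nx}. \<forall>j\<in>{1..Ny}. \<rho> t i j > 0) \<longrightarrow>
        (\<exists>D. ((\<lambda>s. discrete_entropy Nx Ny xe ye V W (\<rho> s)) has_real_derivative D) (at t) \<and>
             D \<le> - entropy_dissipation Nx Ny xe ye V W (\<rho> t)) \<and>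
        entropy_dissipation Nx Ny xe ye V W (\<rho> t) \<ge> 0)"
proof -
  interpret finite_volume_scheme Nx Ny xe ye V W
    by unfold_locales
      (use mesh_cell_width_pos[OF mesh_x] mesh_cell_width_pos[OF mesh_y] in auto)
  show ?thesis
  proof (intro conjI allI impI ballI)
    fix t :: real assume "0 < t"
    then show "total_mass Nx Ny xe ye (\<rho> t) = total_mass Nx Ny xe ye (\<rho> 0)"
      by (intro mass_conserved[OF sol]) simp
  next
    fix t :: real and i j
    assume *: "\<forall>i\<in>{1..Nx}. \<forall>j\<in>{1..Ny}. 0 \<le> \<rho> 0 i j" "0 < t" "i \<in> {1..Nx}" "j \<in> {1..Ny}"
    show "0 \<le> \<rho> t i j"
      by (rule nonnegativity_preserved[OF sol]) (use * in auto)
  next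
    fix t :: real
    assume t: "0 < t" and pos: "\<forall>i\<in>{1..Nx}. \<forall>j\<in>{1..Ny}. 0 < \<rho> t i j"
    have "((\<lambda>s. discrete_entropy Nx Ny xe ye V W (\<rho> s)) has_real_derivative
        - entropy_dissipation Nx Ny xe ye V W (\<rho> t)) (at t within {0..})"
      by (rule entropy_deriv[OF W_sym sol]) (use t pos in auto)
    then show "\<exists>D. ((\<lambda>s. discrete_entropy Nx Ny xe ye V W (\<rho> s)) has_real_derivative D) (at t) \<and>
        D \<le> - entropy_dissipation Nx Ny xe ye V W (\<rho> t)"
      unfolding at_within_half_line[OF t] by blast
    show "0 \<le> entropy_dissipation Nx Ny xe ye V W (\<rho> t)"
      by (rule entropy_dissipation_nonneg) (use pos in auto)
  qed
qed

end
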